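(* Let $(g_n(q))_{n\ge 0}$ be polynomials and let $G(q)=\sum_{n=0}^{\infty}(q;q^2)_n g_n(q)$, understood via its expansions at odd-order roots of unity as described in the context. Let $\nu\in\{0,1\}$, let $a\ge 0$ and $b>0$ be integers, and let $\chi:\mathbb{Z}\to\mathbb{C}$ satisfy: (i) $\chi(n)\neq 0$ only if $\frac{n^2-a}{b}\in\mathbb{Z}$; (ii) for every root of unity $\zeta$, the function $n\mapsto \zeta^{\frac{n^2-a}{b}}\chi(n)$ is periodic with mean value zero. Put $P^{(\nu)}_{a,b,\chi}(q)=\sum_{n\ge 0} n^{\nu}\chi(n)q^{\frac{n^2-a}{b}}$. Suppose that for every root of unity $\zeta$ of odd order we have $P^{(\nu)}_{a,b,\chi}(\zeta e^{-t})\sim G(\zeta e^{-t})$ as $t\to 0^+$. Let $s$ and $N$ be positive integers with $s$ odd, and let $i\in\{0,\dots,s-1\}$ with $i\notin S_{a,b,\chi}(s)$. Then $$(q;q^2)_{\mu(N,1,s)} \ \text{ divides } \ A_{G,s}(N,i,q),$$ where $\mu(N,1,s)=\left\lfloor \frac{N}{s}+\frac12\right\rfloor$.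
   Context: Notation: $(x;q)_n=(1-x)(1-xq)\cdots(1-xq^{n-1})$, so $(q;q^2)_n=(1-q)(1-q^3)\cdots(1-q^{2n-1})$. For $N\ge 0$ let $G(q;N)=\sum_{n=0}^{N} g_n(q)(q;q^2)_n$ and define polynomials $A_{G,s}(N,i,q)$ by the $s$-dissection $G(q;N)=\sum_{i=0}^{s-1}q^iA_{G,s}(N,i,q^s)$. The set $S_{a,b,\chi}(s)\subseteq\{0,\dots,s-1\}$ is the set of reductions modulo $s$ of $\frac{n^2-a}{b}$ over all $n\in\mathbb{Z}$ with $\chi(n)\neq0$. Meaning of $G(\zeta e^{-t})$: if $\zeta$ is a $k$th root of unity with $k$ odd, the value $\left(\frac{d}{dt}\right)^{\ell}G(\zeta e^{-t};N)\big|_{t=0}$ is independent of $N$ for $2N\ge k(2\ell+1)$; call it $\left(\frac{d}{dt}\right)^{\ell}G(\zeta e^{-t})\big|_{t=0}$, and define $G(\zeta e^{-t})$ as the formal power series $\sum_{\ell\ge0}\frac{1}{\ell!}\left(\frac{d}{dt}\right)^{\ell}G(\zeta e^{-t})\big|_{t=0}\,t^\ell$. The statement $P(\zeta e^{-t})\sim\sum_\ell c_\ell t^\ell$ as $t\to0^+$ means that for each $R\ge0$, $P(\zeta e^{-t})-\sum_{\ell=0}^Rc_\ell t^\ell=o(t^R)$ as $t\to0^+$. *)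

theory Defs
  imports "HOL-Analysis.Analysis" "HOL-Computational_Algebra.Computational_Algebra"
    "HOL-Library.Landau_Symbols"
begin

definition qpoch :: "'a::comm_ring_1 \<Rightarrow> 'a \<Rightarrow> nat \<Rightarrow> 'a" where
  "qpoch x q n = (\<Prod>j<n. 1 - x * q ^ j)"

text \<open>The polynomial $(q;q^2)_n$, with $q$ the polynomial variable.\<close>

definition odd_qpoch :: "nat \<Rightarrow> complex poly" where
  "odd_qpoch n = qpoch [:0, 1:] ([:0, 1:] ^ 2) n"

definition G_partial :: "(nat \<Rightarrow> complex poly) \<Rightarrow> nat \<Rightarrow> complex poly" where
  "G_partial g N = (\<Sum>n\<le>N. g n * odd_qpoch n)"

text \<open>
  The \<open>i\<close>-th component of the \<open>s\<close>-dissection of \<open>p\<close>. The lemmas \<open>dissection\<close> and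
  \<open>dissection_unique\<close> below show that for \<open>s > 0\<close> these components are characterised by
  $p(q) = \sum_{i<s} q^i A_i(q^s)$.
\<close>

definition dissect :: "nat \<Rightarrow> nat \<Rightarrow> 'a::comm_ring_1 poly \<Rightarrow> 'a poly" where
  "dissect s i p = (\<Sum>k\<le>degree p. monom (coeff p (s * k + i)) k)"

definition A_G :: "(nat \<Rightarrow> complex poly) \<Rightarrow> nat \<Rightarrow> nat \<Rightarrow> nat \<Rightarrow> complex poly" where
  "A_G g s N i = dissect s i (G_partial g N)"

text \<open>
  The derivative is taken with respect to a complex variable; as the function is entire,
  this agrees at \<open>0\<close> with the derivative along real \<open>t\<close>.
\<close>

definition G_deriv_partial :: "(nat \<Rightarrow> complex poly) \<Rightarrow> complex \<Rightarrow> nat \<Rightarrow> nat \<Rightarrow> complex" where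
  "G_deriv_partial g \<zeta> l N = (deriv ^^ l) (\<lambda>t. poly (G_partial g N) (\<zeta> * exp (- t))) 0"

text \<open>
  The common value of the derivatives above for all large \<open>N\<close>. It is well defined when \<open>\<zeta>\<close>
  is a root of unity of odd order: see \<open>G_deriv_eq\<close> below.
\<close>

definition G_deriv :: "(nat \<Rightarrow> complex poly) \<Rightarrow> complex \<Rightarrow> nat \<Rightarrow> complex" where
  "G_deriv g \<zeta> l = (THE c. \<forall>k N. odd k \<and> \<zeta> ^ k = 1 \<and> k * (2 * l + 1) \<le> 2 * N \<longrightarrow>
                                G_deriv_partial g \<zeta> l N = c)"

definition G_fps :: "(nat \<Rightarrow> complex poly) \<Rightarrow> complex \<Rightarrow> complex fps" where
  "G_fps g \<zeta> = Abs_fps (\<lambda>l. G_deriv g \<zeta> l / fact l)"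

definition has_asymp_expansion_at_0 :: "(real \<Rightarrow> complex) \<Rightarrow> complex fps \<Rightarrow> bool" where
  "has_asymp_expansion_at_0 f F \<longleftrightarrow>
     (\<forall>R. (\<lambda>t. f t - (\<Sum>l\<le>R. fps_nth F l * of_real t ^ l)) \<in> o[at_right 0](\<lambda>t. of_real t ^ R))"

definition periodic_mean_zero :: "(int \<Rightarrow> complex) \<Rightarrow> bool" where
  "periodic_mean_zero f \<longleftrightarrow>
     (\<exists>p>0. (\<forall>n. f (n + p) = f n) \<and> (\<Sum>n\<in>{0..<p}. f n) / of_int p = 0)"

text \<open>
  The exponent $(n^2-a)/b$. Below it only matters for \<open>n\<close> with \<open>chi n \<noteq> 0\<close>, where the division
  is assumed to be exact. It may be negative.
\<close>

definition quad_exp :: "int \<Rightarrow> int \<Rightarrow> int \<Rightarrow> int" where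
  "quad_exp a b n = (n ^ 2 - a) div b"

definition P_series :: "nat \<Rightarrow> int \<Rightarrow> int \<Rightarrow> (int \<Rightarrow> complex) \<Rightarrow> complex \<Rightarrow> complex" where
  "P_series \<nu> a b chi q = (\<Sum>n. of_nat n ^ \<nu> * chi (int n) * q powi quad_exp a b (int n))"

definition S_set :: "int \<Rightarrow> int \<Rightarrow> (int \<Rightarrow> complex) \<Rightarrow> nat \<Rightarrow> nat set" where
  "S_set a b chi s = {nat (quad_exp a b n mod int s) | n. chi n \<noteq> 0}"


lemma coeff_dissect:
  assumes "s > 0"
  shows "coeff (dissect s i p) k = coeff p (s * k + i)"
proof -
  have "coeff (dissect s i p) k = (\<Sum>j\<le>degree p. if j = k then coeff p (s * j + i) else 0)"
    by (simp add: dissect_def coeff_sum)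
  also have "\<dots> = (if k \<le> degree p then coeff p (s * k + i) else 0)"
    by (subst sum.delta) auto
  also have "\<dots> = coeff p (s * k + i)"
  proof (cases "k \<le> degree p")
    case False
    moreover have "k \<le> s * k" using assms by simp
    ultimately have "degree p < s * k + i" by linarith
    thus ?thesis using False by (simp add: coeff_eq_0)
  qed auto
  finally show ?thesis .
qed

lemma coeff_pcompose_monom:
  fixes A :: "'a::comm_ring_1 poly"
  assumes "s > 0"
  shows "coeff (pcompose A (monom 1 s)) n = (if s dvd n then coeff A (n div s) else 0)"
proof (induction A arbitrary: n)
  case (pCons a A)
  show ?case
  proof (cases "n < s")
    case True
    thus ?thesis using assms pCons.IH
      by (auto simp: pcompose_pCons coeff_monom_mult coeff_pCons split: nat.splits)
  next
    case False
    then obtain m where m: "n = s + m" using le_Suc_ex not_less by blast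
    show ?thesis using assms pCons.IH
      by (auto simp: pcompose_pCons coeff_monom_mult coeff_pCons m split: nat.splits)
  qed
qed simp

lemma coeff_dissected_sum:
  fixes A :: "nat \<Rightarrow> 'a::comm_ring_1 poly"
  assumes "s > 0"
  shows "coeff (\<Sum>i<s. monom 1 i * pcompose (A i) (monom 1 s)) n = coeff (A (n mod s)) (n div s)"
proof -
  have "coeff (\<Sum>i<s. monom 1 i * pcompose (A i) (monom 1 s)) n =
        (\<Sum>i<s. if i = n mod s then coeff (A i) (n div s) else 0)"
    unfolding coeff_sum
  proof (rule sum.cong[OF refl], goal_cases)
    case (1 i)
    show ?case
    proof (cases "i \<le> n")
      case True
      have "s dvd n - i \<longleftrightarrow> i = n mod s"
        using 1 True mod_eq_dvd_iff_nat[of i n s] by (auto simp: eq_commute)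
      moreover have "(n - n mod s) div s = n div s"
        using assms by (simp add: minus_mod_eq_mult_div)
      ultimately show ?thesis
        using True assms by (auto simp: coeff_monom_mult coeff_pcompose_monom)
    next
      case False
      hence "i \<noteq> n mod s" using 1 by auto
      thus ?thesis using False by (simp add: coeff_monom_mult)
    qed
  qed
  also have "\<dots> = coeff (A (n mod s)) (n div s)"
    using assms by (subst sum.delta) auto
  finally show ?thesis .
qed

lemma dissection:
  assumes "s > 0"
  shows "p = (\<Sum>i<s. monom 1 i * pcompose (dissect s i p) (monom 1 s))"
  by (rule poly_eqI) (simp only: coeff_dissected_sum[OF assms] coeff_dissect[OF assms] mult_div_mod_eq)

lemma dissection_unique:
  assumes "s > 0" "p = (\<Sum>i<s. monom 1 i * pcompose (A i) (monom 1 s))" "i < s"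
  shows "A i = dissect s i p"
proof (rule poly_eqI)
  fix k
  have "coeff p (s * k + i) = coeff (A i) k"
    using assms(3) by (subst assms(2), subst coeff_dissected_sum[OF assms(1)]) simp
  thus "coeff (A i) k = coeff (dissect s i p) k"
    by (simp add: coeff_dissect[OF assms(1)])
qed

lemma deriv_poly_exp:
  "deriv (\<lambda>t. poly p (\<zeta> * exp (- t))) = (\<lambda>t::complex. poly (- ([:0, 1:] * pderiv p)) (\<zeta> * exp (- t)))"
  by (rule ext, rule DERIV_imp_deriv) (auto intro!: derivative_eq_intros)

lemma higher_deriv_poly_exp:
  "(deriv ^^ l) (\<lambda>t::complex. poly p (\<zeta> * exp (- t))) =
     (\<lambda>t. poly (((\<lambda>r. - ([:0, 1:] * pderiv r)) ^^ l) p) (\<zeta> * exp (- t)))"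
  by (induction l) (auto simp: deriv_poly_exp)

lemma euler_op_dvd:
  fixes p :: "complex poly"
  assumes "[:-\<zeta>, 1:] ^ (m + l) dvd p"
  shows "[:-\<zeta>, 1:] ^ m dvd ((\<lambda>r. - ([:0, 1:] * pderiv r)) ^^ l) p"
  using assms
proof (induction l arbitrary: m)
  case (Suc l)
  have "[:-\<zeta>, 1:] ^ Suc m dvd ((\<lambda>r. - ([:0, 1:] * pderiv r)) ^^ l) p"
    by (rule Suc.IH) (use Suc.prems in simp)
  then obtain r where r: "((\<lambda>r. - ([:0, 1:] * pderiv r)) ^^ l) p = [:-\<zeta>, 1:] ^ Suc m * r" ..
  have "[:-\<zeta>, 1:] ^ m dvd pderiv ([:-\<zeta>, 1:] ^ Suc m * r)"
    unfolding pderiv_mult pderiv_power_Suc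
    by (intro dvd_add dvd_mult dvd_mult2 dvd_smult dvd_refl le_imp_power_dvd) simp
  hence "[:-\<zeta>, 1:] ^ m dvd - ([:0, 1:] * pderiv ([:-\<zeta>, 1:] ^ Suc m * r))"
    by (intro iffD2[OF dvd_minus_iff] dvd_mult)
  thus ?case by (simp only: funpow.simps o_apply r)
qed auto

lemma odd_qpoch_dvd:
  assumes "odd k" "\<zeta> ^ k = 1" "k * (2 * l + 1) \<le> 2 * N"
  shows "[:-\<zeta>, 1:] ^ Suc l dvd odd_qpoch (Suc N + d)"
proof -
  define J where "J = (\<lambda>m. (k * (2 * m + 1)) div 2) ` {..l}"
  have k: "k > 0" using assms(1) by (auto intro!: Nat.gr0I)
  have J2: "2 * ((k * (2 * m + 1)) div 2) + 1 = k * (2 * m + 1)" for m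
    using assms(1) by simp
  have inj: "inj_on (\<lambda>m. (k * (2 * m + 1)) div 2) {..l}"
  proof (rule inj_onI)
    fix x y assume "(k * (2 * x + 1)) div 2 = (k * (2 * y + 1)) div 2"
    hence "k * (2 * x + 1) = k * (2 * y + 1)" using J2 by metis
    thus "x = y" using k by simp
  qed
  have sub: "J \<subseteq> {..<Suc N + d}"
  proof
    fix j assume "j \<in> J"
    then obtain m where m: "m \<le> l" "j = (k * (2 * m + 1)) div 2" by (auto simp: J_def)
    have "k * (2 * m + 1) \<le> k * (2 * l + 1)" using m(1) by simp
    hence "2 * j + 1 \<le> 2 * N" using J2[of m] m assms(3) by linarith
    thus "j \<in> {..<Suc N + d}" by simp
  qed
  have "[:-\<zeta>, 1:] ^ Suc l = (\<Prod>j\<in>J. [:-\<zeta>, 1:])"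
    using inj by (simp add: J_def card_image)
  also have "\<dots> dvd (\<Prod>j\<in>J. 1 - [:0, 1:] * ([:0, 1:] ^ 2) ^ j)"
  proof (rule prod_dvd_prod)
    fix j assume "j \<in> J"
    then obtain m where m: "j = (k * (2 * m + 1)) div 2" by (auto simp: J_def)
    have "\<zeta> * (\<zeta>\<^sup>2) ^ j = \<zeta> ^ (2 * j + 1)" by (simp add: power_mult)
    also have "\<dots> = 1" unfolding m J2 power_mult assms(2) by simp
    finally have "poly (1 - [:0, 1:] * ([:0, 1:] ^ 2) ^ j) \<zeta> = 0" by simp
    thus "[:-\<zeta>, 1:] dvd 1 - [:0, 1:] * ([:0, 1:] ^ 2) ^ j" by (simp only: poly_eq_0_iff_dvd)
  qed
  also have "\<dots> dvd odd_qpoch (Suc N + d)"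
    unfolding odd_qpoch_def qpoch_def by (rule prod_dvd_prod_subset) (use sub in auto)
  finally show ?thesis .
qed

lemma G_deriv_partial_stable:
  assumes "odd k" "\<zeta> ^ k = 1" "k * (2 * l + 1) \<le> 2 * N"
  shows "G_deriv_partial g \<zeta> l (N + d) = G_deriv_partial g \<zeta> l N"
proof -
  define \<theta> where "\<theta> = (\<lambda>r::complex poly. - ([:0, 1:] * pderiv r))"
  have add: "(\<theta> ^^ l) (p + q) = (\<theta> ^^ l) p + (\<theta> ^^ l) q" for l p q
    by (induction l) (simp_all add: \<theta>_def pderiv_add algebra_simps)
  have "G_deriv_partial g \<zeta> l (Suc (N + d)) = G_deriv_partial g \<zeta> l (N + d)" for d
  proof -
    have "[:-\<zeta>, 1:] ^ (1 + l) dvd g (Suc (N + d)) * odd_qpoch (Suc N + d)"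
      using odd_qpoch_dvd[OF assms] by (simp add: dvd_mult del: power_Suc)
    from euler_op_dvd[OF this] have "poly ((\<theta> ^^ l) (g (Suc (N + d)) * odd_qpoch (Suc N + d))) \<zeta> = 0"
      by (simp add: poly_eq_0_iff_dvd \<theta>_def)
    thus ?thesis
      unfolding G_deriv_partial_def G_partial_def higher_deriv_poly_exp \<theta>_def[symmetric]
      by (simp add: add)
  qed
  thus ?thesis by (induction d) auto
qed

lemma G_deriv_eq:
  assumes "odd k" "\<zeta> ^ k = 1" "k * (2 * l + 1) \<le> 2 * N"
  shows "G_deriv g \<zeta> l = G_deriv_partial g \<zeta> l N"
  unfolding G_deriv_def
proof (rule the_equality)
  show "\<forall>k' N'. odd k' \<and> \<zeta> ^ k' = 1 \<and> k' * (2 * l + 1) \<le> 2 * N' \<longrightarrow>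
          G_deriv_partial g \<zeta> l N' = G_deriv_partial g \<zeta> l N"
    using G_deriv_partial_stable assms by (metis add.commute)
qed (use assms in blast)

end

theory Submission
  imports Defs
begin

text \<open>
  Let \<open>w\<close> be a primitive \<open>s\<close>-th root of unity. The root-of-unity filter
  $\sum_{j<s} w^{-ij} F(w^j q)$ turns \<open>F = G_partial g N\<close> into $s\, q^i A_i(q^s)$ and annihilates
  $P$, because no exponent of $P$ is congruent to \<open>i\<close> modulo \<open>s\<close>. If $\omega = \zeta^s$ has odd
  order \<open>k\<close>, all the points $w^j \zeta$ are roots of unity of odd order dividing \<open>sk\<close>, so the
  expansion of the filtered $P$ at $\zeta$, which is zero, gives the derivatives of order \<open>l\<close> of
  $q^i A_i(q^s)$ along $q = \zeta e^{-t}$ as long as $sk(2l+1) \le 2N$. The number of such \<open>l\<close> is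
  at least the multiplicity of $\omega$ in $(q;q^2)_\mu$.
\<close>

section \<open>Orders of zeros and divisibility of complex polynomials\<close>

text \<open>Over the complex numbers a nonzero polynomial is its leading coefficient, a unit, times
  the linear factors of its roots, so divisibility reduces to inclusion of root multisets.\<close>

lemma poly_dvd_of_order_le:
  fixes p q :: "complex poly"
  assumes "p \<noteq> 0" "q \<noteq> 0" "\<And>x. order x p \<le> order x q"
  shows "p dvd q"
proof -
  have "proots p \<subseteq># proots q"
    using assms by (intro mset_subset_eqI) simp
  hence "(\<Prod>x\<in>#proots p. [:-x, 1:]) dvd (\<Prod>x\<in>#proots q. [:-x, 1:])"
    by (intro prod_mset_subset_imp_dvd image_mset_subseteq_mono)
  hence "smult (lead_coeff p) (\<Prod>x\<in>#proots p. [:-x, 1:]) dvd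
         smult (lead_coeff q) (\<Prod>x\<in>#proots q. [:-x, 1:])"
    using assms by (intro smult_dvd dvd_smult) auto
  thus ?thesis by (simp only: complex_poly_decompose_multiset)
qed

lemma order_prod_eq_sum:
  fixes f :: "'b \<Rightarrow> 'a::idom poly"
  assumes "finite A" "\<And>x. x \<in> A \<Longrightarrow> f x \<noteq> 0"
  shows "order a (prod f A) = (\<Sum>x\<in>A. order a (f x))"
  using assms by (induction rule: finite_induct) (auto simp: order_mult order_0I)

lemma monom_minus_const_nonzero:
  assumes "s > 0"
  shows "monom 1 s - [:c:] \<noteq> (0 :: 'a::comm_ring_1 poly)"
proof
  assume "monom 1 s - [:c:] = (0 :: 'a poly)"
  hence "coeff (monom 1 s - [:c:]) s = (0 :: 'a)" by simp
  thus False using assms by (cases s) auto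
qed

text \<open>The zero is simple because the derivative \<open>s * q ^ (s - 1)\<close> does not vanish
  away from 0.\<close>

lemma order_monom_minus_const:
  fixes \<zeta> :: complex
  assumes "s > 0" "\<zeta> \<noteq> 0"
  shows "order \<zeta> (monom 1 s - [:\<zeta> ^ s:]) = 1"
proof -
  let ?p = "monom 1 s - [:\<zeta> ^ s:]"
  have d: "poly (pderiv ?p) \<zeta> \<noteq> 0"
    using assms by (simp add: pderiv_diff pderiv_monom poly_monom)
  moreover have "order \<zeta> ?p = Suc (order \<zeta> (pderiv ?p))"
    using monom_minus_const_nonzero[OF assms(1)] by (intro order_pderiv) (auto simp: poly_monom)
  ultimately show ?thesis by (simp add: order_0I)
qed

text \<open>The map q -> q^s is unramified away from 0, so pulling back along it preserves
  multiplicities; the factor q^i does not vanish at \<zeta>. This transfers the zeros found for the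
  filtered polynomial back to \<open>A\<close>.\<close>

lemma order_pcompose_monom:
  fixes A :: "complex poly"
  assumes "s > 0" "\<zeta> \<noteq> 0" "A \<noteq> 0"
  shows "order \<zeta> (monom 1 i * pcompose A (monom 1 s)) = order (\<zeta> ^ s) A"
proof -
  define m where "m = order (\<zeta> ^ s) A"
  obtain u where u: "A = [:-(\<zeta> ^ s), 1:] ^ m * u" "\<not> [:-(\<zeta> ^ s), 1:] dvd u"
    using order_decomp[OF assms(3), of "\<zeta> ^ s"] by (auto simp: m_def)
  have uz: "poly u (\<zeta> ^ s) \<noteq> 0" using u(2) by (simp add: poly_eq_0_iff_dvd)
  let ?v = "monom 1 i * pcompose u (monom 1 s)"
  have v: "poly ?v \<zeta> \<noteq> 0" using uz assms by (simp add: poly_pcompose poly_monom)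
  have lin: "pcompose [:-(\<zeta> ^ s), 1:] (monom 1 s) = monom 1 s - [:\<zeta> ^ s:]"
    by (simp add: pcompose_pCons algebra_simps flip: minus_pCons)
  have l0: "monom 1 s - [:\<zeta> ^ s:] \<noteq> 0"
    using assms(1) by (rule monom_minus_const_nonzero)
  \<comment> \<open>The power is treated as a product of \<open>m\<close> equal factors so that
    composition distributes over it.\<close>
  have "pcompose ([:-(\<zeta> ^ s), 1:] ^ m) (monom 1 s) = (monom 1 s - [:\<zeta> ^ s:]) ^ m"
    using pcompose_prod[of "\<lambda>_. [:-(\<zeta> ^ s), 1:]" "{..<m}" "monom 1 s"] lin by simp
  hence eq: "monom 1 i * pcompose A (monom 1 s) = (monom 1 s - [:\<zeta> ^ s:]) ^ m * ?v"
    by (subst u(1)) (simp only: pcompose_mult mult_ac)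
  have "?v \<noteq> 0" using v by auto
  hence "order \<zeta> (monom 1 i * pcompose A (monom 1 s)) = order \<zeta> ((monom 1 s - [:\<zeta> ^ s:]) ^ m)"
    unfolding eq using l0 v by (subst order_mult) (auto simp: order_0I)
  also have "\<dots> = m"
    using order_prod_eq_sum[of "{..<m}" "\<lambda>_. monom 1 s - [:\<zeta> ^ s:]" \<zeta>] l0
      order_monom_minus_const[OF assms(1,2)] by simp
  finally show ?thesis by (simp add: m_def)
qed

section \<open>The Euler operator -q d/dq\<close>

text \<open>Away from 0 the operator -q d/dq lowers the order of a zero by exactly one. Since it is
  d/dt along q = \<zeta> e^{-t}, vanishing t-derivatives become a power of the linear
  factor.\<close>

lemma euler_op_dvd_converse:
  fixes p :: "complex poly"
  assumes "\<zeta> \<noteq> 0" "\<And>l. l < M \<Longrightarrow> poly (((\<lambda>r. - ([:0, 1:] * pderiv r)) ^^ l) p) \<zeta> = 0"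
  shows "[:-\<zeta>, 1:] ^ M dvd p"
  using assms(2)
proof (induction M arbitrary: p)
  case (Suc M)
  let ?d = "- ([:0, 1:] * pderiv p)"
  have "[:-\<zeta>, 1:] ^ M dvd ?d"
  proof (rule Suc.IH)
    fix l assume "l < M"
    thus "poly (((\<lambda>r. - ([:0, 1:] * pderiv r)) ^^ l) ?d) \<zeta> = 0"
      using Suc.prems[of "Suc l"] by (simp only: funpow_Suc_right o_apply)
  qed
  hence M: "?d = 0 \<or> M \<le> order \<zeta> ?d" by (simp only: order_divides)
  have root: "poly p \<zeta> = 0" using Suc.prems[of 0] by simp
  show ?case
  \<comment> \<open>A constant with a zero is 0; otherwise the order of \<open>p\<close> exceeds
    that of its derivative by one.\<close>
  proof (cases "pderiv p = 0")
    case True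
    then obtain c where "p = [:c:]" using pderiv_iszero by blast
    thus ?thesis using root by simp
  next
    case False
    hence p0: "p \<noteq> 0" by auto
    have "order \<zeta> ?d = order \<zeta> [:0, 1:] + order \<zeta> (pderiv p)"
      using False unfolding order_uminus by (subst order_mult) auto
    also have "order \<zeta> [:0, 1:] = 0" using assms(1) by (intro order_0I) simp
    finally have "M \<le> order \<zeta> (pderiv p)" using M False by auto
    moreover have "order \<zeta> p = Suc (order \<zeta> (pderiv p))"
      using p0 root by (rule order_pderiv)
    ultimately show ?thesis by (simp only: order_divides) simp
  qed
qed simp

lemma euler_op_smult:
  "((\<lambda>r. - ([:0, 1:] * pderiv r)) ^^ l) (smult c p :: complex poly) =
     smult c (((\<lambda>r. - ([:0, 1:] * pderiv r)) ^^ l) p)"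
  by (induction l) (simp_all add: pderiv_smult)

lemma euler_op_sum:
  fixes f :: "'b \<Rightarrow> complex poly"
  shows "((\<lambda>r. - ([:0, 1:] * pderiv r)) ^^ l) (sum f A) =
     (\<Sum>x\<in>A. ((\<lambda>r. - ([:0, 1:] * pderiv r)) ^^ l) (f x))"
proof (induction l)
  case (Suc l)
  have "pderiv (sum h A) = (\<Sum>x\<in>A. pderiv (h x))" for h :: "'b \<Rightarrow> complex poly"
    using higher_pderiv_sum[of 1 h A] by simp
  thus ?case unfolding funpow.simps o_apply Suc
    by (simp only: sum_distrib_left sum_negf)
qed simp

section \<open>Linearity and uniqueness of asymptotic expansions\<close>

lemma has_asymp_expansion_at_0_sum:
  assumes "finite A" "\<And>x. x \<in> A \<Longrightarrow> has_asymp_expansion_at_0 (f x) (F x)"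
  shows "has_asymp_expansion_at_0 (\<lambda>t. \<Sum>x\<in>A. c x * f x t) (\<Sum>x\<in>A. fps_const (c x) * F x)"
  unfolding has_asymp_expansion_at_0_def
proof
  fix R
  let ?e = "\<lambda>x t. f x t - (\<Sum>l\<le>R. fps_nth (F x) l * of_real t ^ l)"
  have "(\<lambda>t. \<Sum>x\<in>A. c x * ?e x t) \<in> o[at_right 0](\<lambda>t. of_real t ^ R)"
  proof (rule big_sum_in_smallo)
    fix x assume "x \<in> A"
    thus "(\<lambda>t. c x * ?e x t) \<in> o[at_right 0](\<lambda>t. of_real t ^ R)"
      using assms(2)[of x] by (cases "c x = 0") (simp_all add: has_asymp_expansion_at_0_def)
  qed
  also have "(\<lambda>t. \<Sum>x\<in>A. c x * ?e x t) = (\<lambda>t. (\<Sum>x\<in>A. c x * f x t) -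
      (\<Sum>l\<le>R. fps_nth (\<Sum>x\<in>A. fps_const (c x) * F x) l * of_real t ^ l))"
    by (rule ext, simp add: fps_sum_nth right_diff_distrib sum_subtractf sum_distrib_left
      sum_distrib_right mult.assoc, rule sum.swap)
  finally show "\<dots> \<in> o[at_right 0](\<lambda>t. of_real t ^ R)" .
qed

text \<open>If all coefficients below \<open>R\<close> vanish, the remainder of order
  \<open>R\<close> is the single term of degree \<open>R\<close>, which can be o(t^R) only with
  coefficient 0.\<close>

lemma has_asymp_expansion_at_0_zero:
  assumes "has_asymp_expansion_at_0 f F" "\<And>t. t > 0 \<Longrightarrow> f t = 0"
  shows "F = 0"
proof (rule fps_ext)
  fix R
  show "fps_nth F R = fps_nth 0 R"
  proof (induction R rule: less_induct)
    case (less R)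
    have "(\<lambda>t. f t - (\<Sum>l\<le>R. fps_nth F l * of_real t ^ l)) \<in> o[at_right 0](\<lambda>t. of_real t ^ R)"
      using assms(1) by (simp add: has_asymp_expansion_at_0_def)
    moreover have "\<forall>\<^sub>F t in at_right 0. f t - (\<Sum>l\<le>R. fps_nth F l * of_real t ^ l) =
        - fps_nth F R * of_real t ^ R"
      using eventually_at_right_less[of 0]
    proof eventually_elim
      case (elim t)
      have "(\<Sum>l\<le>R. fps_nth F l * of_real t ^ l) = (\<Sum>l\<in>{R}. fps_nth F l * of_real t ^ l)"
        using less by (intro sum.mono_neutral_right) auto
      thus ?case using assms(2)[OF elim] by simp
    qed
    ultimately have "(\<lambda>t. - fps_nth F R * of_real t ^ R) \<in> o[at_right 0](\<lambda>t. of_real t ^ R)"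
      by (subst (asm) landau_o.small.in_cong) auto
    hence "((\<lambda>t. (- fps_nth F R * of_real t ^ R) / of_real t ^ R) \<longlongrightarrow> 0) (at_right 0)"
      by (rule smalloD_tendsto)
    moreover have "\<forall>\<^sub>F t in at_right (0::real).
        (- fps_nth F R * of_real t ^ R) / of_real t ^ R = - fps_nth F R"
      using eventually_at_right_less[of 0] by eventually_elim auto
    ultimately have "((\<lambda>_. - fps_nth F R) \<longlongrightarrow> 0) (at_right (0::real))"
      by (rule Lim_transform_eventually)
    thus ?case by (simp add: tendsto_const_iff)
  qed
qed

section \<open>The root-of-unity filter\<close>

lemma obtain_primitive_root:
  assumes "s > 0"
  obtains w :: complex where "\<And>m. w ^ m = 1 \<longleftrightarrow> s dvd m"
proof
  fix m
  have "exp (2 * of_real pi * \<i> / of_nat s) ^ m = exp (2 * of_real pi * \<i> * of_nat m / of_nat s)"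
    by (simp add: mult_ac flip: exp_of_nat_mult)
  thus "exp (2 * of_real pi * \<i> / of_nat s) ^ m = 1 \<longleftrightarrow> s dvd m"
    using complex_root_unity_eq_1[of s m] assms by simp
qed

text \<open>This is a geometric sum in u = w^(e - i), where u^s = 1. Integer powers are used because
  exponents of P may be negative.\<close>

lemma sum_powi_root_of_unity:
  fixes w :: complex
  assumes "s > 0" "\<And>m. w ^ m = 1 \<longleftrightarrow> s dvd m" "i < s"
  shows "(\<Sum>j<s. inverse (w ^ (i * j)) * (w ^ j) powi e) =
           (if e mod int s = int i then of_nat s else 0)"
proof -
  have ws: "w ^ s = 1" using assms(2) by simp
  hence w0: "w \<noteq> 0" using assms(1) by (auto simp: power_0_left)
  define u where "u = w powi (e - int i)"
  have us: "u ^ s = 1"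
  proof -
    have "u ^ s = (w powi int s) powi (e - int i)"
      unfolding u_def by (simp flip: power_int_mult power_int_of_nat add: mult.commute)
    thus ?thesis using ws by simp
  qed
  \<comment> \<open>The nonnegative residue \<open>d\<close> turns \<open>u\<close> into a natural
    power of \<open>w\<close>, to which the hypothesis on \<open>w\<close> applies.\<close>
  define d where "d = nat ((e - int i) mod int s)"
  have "e - int i = int s * ((e - int i) div int s) + int d"
    using assms(1) by (simp add: d_def)
  hence "u = (w powi int s) powi ((e - int i) div int s) * w powi int d"
    unfolding u_def power_int_mult[symmetric] using w0 by (metis power_int_add)
  hence "u = w ^ d" using ws by simp
  hence "u = 1 \<longleftrightarrow> int s dvd int d" using assms(2) by simp
  also have "\<dots> \<longleftrightarrow> int s dvd e - int i" using assms(1) by (simp add: d_def dvd_mod_iff)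
  also have "\<dots> \<longleftrightarrow> e mod int s = int i" using assms(3) by (simp flip: mod_eq_dvd_iff)
  finally have u1: "u = 1 \<longleftrightarrow> e mod int s = int i" .
  have "inverse (w ^ (i * j)) * (w ^ j) powi e = u ^ j" for j
  proof -
    have "(w ^ j) powi e = (w powi e) ^ j"
      by (simp flip: power_int_mult power_int_of_nat add: mult.commute)
    thus ?thesis using w0 by (simp add: u_def power_int_diff power_divide power_mult field_simps)
  qed
  hence "(\<Sum>j<s. inverse (w ^ (i * j)) * (w ^ j) powi e) = (\<Sum>j<s. u ^ j)" by simp
  also have "\<dots> = (if u = 1 then of_nat s else 0)"
    using us by (auto simp: geometric_sum)
  finally show ?thesis by (simp add: u1)
qed

section \<open>Convergence and dissection of the series P\<close>

lemma periodic_int_bounded: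
  fixes f :: "int \<Rightarrow> complex"
  assumes "p > 0" "\<And>n. f (n + p) = f n"
  obtains B where "\<And>n. norm (f n) \<le> B"
proof
  fix n
  have per: "f (m + p * int k) = f m" for m k
    by (induction k arbitrary: m) (use assms(2) in \<open>simp_all add: algebra_simps flip: add.assoc\<close>)
  have "f n = f (n mod p)"
  proof (cases "n div p \<ge> 0")
    case True
    thus ?thesis using per[of "n mod p" "nat (n div p)"] by simp
  next
    case False
    hence "n + p * int (nat (- (n div p))) = n mod p"
      by (simp add: minus_mult_div_eq_mod[symmetric])
    thus ?thesis using per[of n "nat (- (n div p))"] by simp
  qed
  thus "norm (f n) \<le> (\<Sum>m\<in>{0..<p}. norm (f m))"
    using assms(1) by (auto intro!: member_le_sum)
qed

text \<open>The exponents grow at least linearly, so the terms are eventually dominated by B (n+1)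
  |q|^n, a multiple of the differentiated geometric series.\<close>

lemma summable_P_series:
  fixes q :: complex
  assumes "\<nu> \<le> 1" "a \<ge> 0" "b > 0" "\<And>n. norm (chi n) \<le> B" "norm q < 1" "q \<noteq> 0"
  shows "summable (\<lambda>n. of_nat n ^ \<nu> * chi (int n) * q powi quad_exp a b (int n))"
proof (rule summable_comparison_test')
  show "summable (\<lambda>n. B * (of_nat (Suc n) * norm q ^ n))"
    using geometric_deriv_sums[of "norm q"] assms(5)
    by (intro summable_mult) (simp add: sums_iff)
next
  fix n assume n: "n \<ge> nat (a + b)"
  \<comment> \<open>For n \<ge> a + b one has n^2 \<ge> na + nb \<ge> a + nb, the last step using n
    \<ge> 1.\<close>
  have "int n * b \<le> int n ^ 2 - a"
  proof -
    have "a + b \<le> int n" using n assms by linarith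
    hence "int n * (a + b) \<le> int n * int n" by (intro mult_left_mono) auto
    moreover have "1 * a \<le> int n * a"
      using \<open>a + b \<le> int n\<close> assms by (intro mult_right_mono) auto
    ultimately show ?thesis by (simp add: power2_eq_square algebra_simps)
  qed
  hence "int n \<le> quad_exp a b (int n)"
    using assms(3) by (metis quad_exp_def zdiv_mono1 nonzero_mult_div_cancel_right less_irrefl)
  hence "norm q powi quad_exp a b (int n) \<le> norm q powi int n"
    using assms by (intro power_int_decreasing) auto
  hence 1: "norm (q powi quad_exp a b (int n)) \<le> norm q ^ n"
    by (simp add: norm_power_int)
  have 2: "real n ^ \<nu> \<le> real (Suc n)" using assms(1) by (cases \<nu>) auto
  have "norm (of_nat n ^ \<nu> * chi (int n) * q powi quad_exp a b (int n)) =
          real n ^ \<nu> * norm (chi (int n)) * norm (q powi quad_exp a b (int n))"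
    by (simp add: norm_mult norm_power)
  also have "\<dots> \<le> real (Suc n) * B * norm q ^ n"
    using 1 2 assms(4)[of "int n"] order_trans[OF norm_ge_zero assms(4)]
    by (intro mult_mono) auto
  finally show "norm (of_nat n ^ \<nu> * chi (int n) * q powi quad_exp a b (int n)) \<le>
                  B * (of_nat (Suc n) * norm q ^ n)"
    by (simp add: mult_ac)
qed

text \<open>Applied term by term, the filter keeps only exponents congruent to \<open>i\<close>
  modulo \<open>s\<close>; by the choice of \<open>i\<close>, those terms have coefficient
  \<open>chi\<close> equal to 0. Summability justifies exchanging the finite and infinite
  sums.\<close>

lemma P_series_dissection_vanishes:
  fixes q w :: complex
  assumes "\<nu> \<le> 1" "a \<ge> 0" "b > 0" "\<And>n. norm (chi n) \<le> B" "norm q < 1" "q \<noteq> 0"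
    and "s > 0" "\<And>m. w ^ m = 1 \<longleftrightarrow> s dvd m" "i < s" "i \<notin> S_set a b chi s"
  shows "(\<Sum>j<s. inverse (w ^ (i * j)) * P_series \<nu> a b chi (w ^ j * q)) = 0"
proof -
  have ws: "w ^ s = 1" using assms(8) by simp
  have w0: "w \<noteq> 0" using ws assms(7) by (auto simp: power_0_left)
  have w1: "norm w = 1" using power_eq_1_iff[OF ws] assms(7) by simp
  let ?f = "\<lambda>j n. inverse (w ^ (i * j)) *
              (of_nat n ^ \<nu> * chi (int n) * (w ^ j * q) powi quad_exp a b (int n))"
  have sm: "summable (\<lambda>n. of_nat n ^ \<nu> * chi (int n) * (w ^ j * q) powi quad_exp a b (int n))" for j
    using assms w0 w1 by (intro summable_P_series[where B = B]) (auto simp: norm_mult norm_power)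
  have "(\<Sum>j<s. inverse (w ^ (i * j)) * P_series \<nu> a b chi (w ^ j * q)) = (\<Sum>j<s. \<Sum>n. ?f j n)"
    using sm by (simp add: P_series_def suminf_mult)
  also have "\<dots> = (\<Sum>n. \<Sum>j<s. ?f j n)"
    using sm by (intro suminf_sum[symmetric] summable_mult)
  also have "(\<lambda>n. \<Sum>j<s. ?f j n) = (\<lambda>_. 0)"
  proof
    fix n
    let ?e = "quad_exp a b (int n)"
    have "(\<Sum>j<s. ?f j n) = of_nat n ^ \<nu> * chi (int n) * q powi ?e *
            (\<Sum>j<s. inverse (w ^ (i * j)) * (w ^ j) powi ?e)"
      by (simp add: sum_distrib_left power_int_mult_distrib mult_ac)
    also have "\<dots> = 0"
    proof (cases "chi (int n) = 0")
      case False
      hence "nat (?e mod int s) \<noteq> i" using assms(10) by (auto simp: S_set_def)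
      hence "?e mod int s \<noteq> int i" by auto
      thus ?thesis using sum_powi_root_of_unity[OF assms(7-9), of ?e] by simp
    qed simp
    finally show "(\<Sum>j<s. ?f j n) = 0" .
  qed
  finally show ?thesis by simp
qed

section \<open>The filter on polynomials\<close>

text \<open>At the point w^j x every component is evaluated at (w^j x)^s = x^s, so only the
  prefactors w^(jk) depend on \<open>j\<close>, and the filter selects k = i.\<close>

lemma sum_dissect_root_of_unity:
  fixes p :: "complex poly" and w :: complex
  assumes "s > 0" "\<And>m. w ^ m = 1 \<longleftrightarrow> s dvd m" "i < s"
  shows "(\<Sum>j<s. smult (inverse (w ^ (i * j))) (pcompose p [:0, w ^ j:])) =
           smult (of_nat s) (monom 1 i * pcompose (dissect s i p) (monom 1 s))"
proof -
  have ws: "(w ^ j) ^ s = 1" for j using assms(2)[of "j * s"] by (simp add: power_mult)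
  have "poly (\<Sum>j<s. smult (inverse (w ^ (i * j))) (pcompose p [:0, w ^ j:])) x =
        poly (smult (of_nat s) (monom 1 i * pcompose (dissect s i p) (monom 1 s))) x" for x
  proof -
    have p: "poly p y = (\<Sum>k<s. y ^ k * poly (dissect s k p) (y ^ s))" for y
      by (subst dissection[OF assms(1), of p]) (simp add: poly_sum poly_pcompose poly_monom)
    have "poly (\<Sum>j<s. smult (inverse (w ^ (i * j))) (pcompose p [:0, w ^ j:])) x =
        (\<Sum>j<s. \<Sum>k<s. inverse (w ^ (i * j)) * (w ^ j) powi int k *
           (x ^ k * poly (dissect s k p) (x ^ s)))"
      by (simp add: poly_sum poly_pcompose p power_mult_distrib ws sum_distrib_left mult_ac)
    also have "\<dots> = (\<Sum>k<s. (\<Sum>j<s. inverse (w ^ (i * j)) * (w ^ j) powi int k) *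
           (x ^ k * poly (dissect s k p) (x ^ s)))"
      by (subst sum.swap) (simp only: sum_distrib_right)
    also have "\<dots> = (\<Sum>k<s. if k = i then of_nat s * (x ^ i * poly (dissect s i p) (x ^ s)) else 0)"
      by (intro sum.cong refl, subst sum_powi_root_of_unity[OF assms]) auto
    also have "\<dots> = of_nat s * (x ^ i * poly (dissect s i p) (x ^ s))"
      using assms(3) by simp
    finally show ?thesis by (simp add: poly_pcompose poly_monom)
  qed
  thus ?thesis by (simp add: poly_eq_poly_eq_iff[symmetric] fun_eq_iff)
qed

section \<open>Zeros of (q;q^2)_m\<close>

lemma odd_qpoch_nonzero: "odd_qpoch m \<noteq> 0"
proof -
  have "poly (odd_qpoch m) 0 = 1"
    by (simp add: odd_qpoch_def qpoch_def poly_prod)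
  thus ?thesis by auto
qed

text \<open>Each factor 1 - q^(2j+1) has at most a simple zero at \<omega>, so the order counts the
  j < \<mu> with \<omega>^(2j+1) = 1. If k is the order of \<omega>, these satisfy 2j+1 = k(2m+1),
  and the hypothesis bounds the distinct values m by \<open>M\<close>.\<close>

lemma order_odd_qpoch_le:
  fixes \<omega> :: complex
  assumes "\<And>k l. odd k \<Longrightarrow> \<omega> ^ k = 1 \<Longrightarrow> k * (2 * l + 1) \<le> 2 * \<mu> - 1 \<Longrightarrow> l < M"
  shows "order \<omega> (odd_qpoch \<mu>) \<le> M"
proof -
  have fac: "1 - [:0, 1:] * ([:0, 1:] ^ 2) ^ j = 1 - monom (1::complex) (2 * j + 1)" for j
    by (simp add: monom_altdef power_mult)
  have ord: "order \<omega> (1 - monom 1 (2 * j + 1)) = (if \<omega> ^ (2 * j + 1) = 1 then 1 else 0)" for j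
  proof (cases "\<omega> ^ (2 * j + 1) = 1")
    case True
    hence "\<omega> \<noteq> 0" by auto
    hence "order \<omega> (monom 1 (2 * j + 1) - 1) = 1"
      using order_monom_minus_const[of "2 * j + 1" \<omega>] True by (simp add: one_pCons)
    thus ?thesis using True order_uminus[of \<omega> "monom 1 (2 * j + 1) - 1"] by simp
  qed (auto simp: order_0I poly_monom)
  have nz: "1 - monom (1::complex) (2 * j + 1) \<noteq> 0" for j
  proof -
    have "poly (1 - monom (1::complex) (2 * j + 1)) 0 = 1" by (simp add: poly_monom)
    thus ?thesis by (metis poly_0 zero_neq_one)
  qed
  let ?J = "{j\<in>{..<\<mu>}. \<omega> ^ (2 * j + 1) = 1}"
  have "order \<omega> (odd_qpoch \<mu>) = (\<Sum>j<\<mu>. order \<omega> (1 - monom 1 (2 * j + 1)))"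
    unfolding odd_qpoch_def qpoch_def fac by (rule order_prod_eq_sum[OF finite_lessThan nz])
  also have "\<dots> = (\<Sum>j<\<mu>. if \<omega> ^ (2 * j + 1) = 1 then 1 else 0)"
    by (simp only: ord)
  also have "\<dots> = card ?J" by (simp add: sum.If_cases Int_def)
  also have "\<dots> \<le> M"
  \<comment> \<open>If some factor vanishes, \<omega> has a finite order \<open>k\<close>, odd
    because it divides an odd number.\<close>
  proof (cases "?J = {}")
    case False
    define k where "k = (LEAST k. k > 0 \<and> \<omega> ^ k = 1)"
    obtain j0 where j0: "\<omega> ^ (2 * j0 + 1) = 1" using False by auto
    have k: "k > 0 \<and> \<omega> ^ k = 1" unfolding k_def by (rule LeastI[of _ "2 * j0 + 1"]) (use j0 in auto)
    have kdvd: "k dvd m" if "\<omega> ^ m = 1" for m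
    proof -
      have "\<omega> ^ m = (\<omega> ^ k) ^ (m div k) * \<omega> ^ (m mod k)"
        by (simp flip: power_mult power_add)
      hence "\<omega> ^ (m mod k) = 1" using k that by simp
      hence "m mod k = 0"
        using not_less_Least[of "m mod k" "\<lambda>k. k > 0 \<and> \<omega> ^ k = 1"] k
        by (auto simp: k_def[symmetric])
      thus ?thesis by auto
    qed
    have "odd k" using dvd_trans[of 2 k, OF _ kdvd[OF j0]] by auto
    \<comment> \<open>This recovers m from 2j+1 = k(2m+1), the cofactor being odd.\<close>
    let ?h = "\<lambda>j. (2 * j + 1) div k div 2"
    have h: "k * (2 * ?h j + 1) = 2 * j + 1" if "j \<in> ?J" for j
    proof -
      have d: "k dvd 2 * j + 1" using that kdvd by auto
      hence e: "k * ((2 * j + 1) div k) = 2 * j + 1" by simp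
      hence "odd ((2 * j + 1) div k)" by (metis even_mult_iff even_plus_one_iff dvd_triv_left)
      thus ?thesis using e by simp
    qed
    have "inj_on ?h ?J"
    proof (rule inj_onI)
      fix x y assume xy: "x \<in> ?J" "y \<in> ?J" "?h x = ?h y"
      have "2 * x + 1 = 2 * y + 1" 
        using trans[OF h[OF xy(1), symmetric, unfolded xy(3)] h[OF xy(2)]] .
      thus "x = y" by simp
    qed
    moreover have "?h ` ?J \<subseteq> {..<M}"
    proof
      fix m assume "m \<in> ?h ` ?J"
      then obtain j where j: "j \<in> ?J" "m = ?h j" by auto
      have "k * (2 * m + 1) = 2 * j + 1" unfolding j(2) by (rule h[OF j(1)])
      hence "k * (2 * m + 1) \<le> 2 * \<mu> - 1" using j(1) by auto
      thus "m \<in> {..<M}" using assms \<open>odd k\<close> k by auto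
    qed
    ultimately show ?thesis using card_inj_on_le[of ?h ?J "{..<M}"] by simp
  qed (simp only: card.empty)
  finally show ?thesis .
qed

section \<open>Divisibility of the dissection components\<close>

theorem theorem1p3:
  fixes g :: "nat \<Rightarrow> complex poly"
    and \<nu> s N i :: nat
    and a b :: int
    and chi :: "int \<Rightarrow> complex"
  assumes "\<nu> \<in> {0, 1}"
    and "a \<ge> 0" and "b > 0"
    and "\<And>n. chi n \<noteq> 0 \<Longrightarrow> b dvd n ^ 2 - a"
    and "\<And>\<zeta> k. k > 0 \<Longrightarrow> \<zeta> ^ k = 1 \<Longrightarrow>
           periodic_mean_zero (\<lambda>n. \<zeta> powi quad_exp a b n * chi n)"
    and "\<And>\<zeta> k. odd k \<Longrightarrow> \<zeta> ^ k = 1 \<Longrightarrow>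
           has_asymp_expansion_at_0
             (\<lambda>t. P_series \<nu> a b chi (\<zeta> * exp (- of_real t))) (G_fps g \<zeta>)"
    and "s > 0" and "odd s" and "N > 0"
    and "i < s" and "i \<notin> S_set a b chi s"
  shows "odd_qpoch (nat \<lfloor>real N / real s + 1 / 2\<rfloor>) dvd A_G g s N i"
proof (cases "A_G g s N i = 0")
  case False
  define A where "A = A_G g s N i"
  define \<mu> where "\<mu> = nat \<lfloor>real N / real s + 1 / 2\<rfloor>"
  \<comment> \<open>The largest exponent among the factors of (q;q^2)_\<mu> is 2\<mu> - 1. The half
    in the floor yields s(2\<mu> - 1) \<le> 2N, which is what stabilisation of the derivatives at
    \<open>N\<close> requires; truncated subtraction is harmless for \<mu> = 0.\<close>
  have "real \<mu> \<le> real N / real s + 1 / 2" unfolding \<mu>_def by simp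
  hence "real s * (2 * real \<mu>) \<le> 2 * real N + real s"
    using \<open>s > 0\<close> by (simp add: field_simps)
  hence "real (s * (2 * \<mu>)) \<le> real (2 * N + s)" by simp
  hence \<mu>: "s * (2 * \<mu> - 1) \<le> 2 * N" by (simp only: of_nat_le_iff) (simp add: diff_mult_distrib2)

  \<comment> \<open>The case \<zeta> = 1 makes \<open>chi\<close> periodic, hence bounded, as
    convergence of P requires.\<close>
  have "periodic_mean_zero chi" using assms(5)[of 1 1] by simp
  then obtain p where "p > 0" "\<And>n. chi (n + p) = chi n" by (auto simp: periodic_mean_zero_def)
  then obtain B where B: "\<And>n. norm (chi n) \<le> B" using periodic_int_bounded by metis
  obtain w :: complex where w: "\<And>m. w ^ m = 1 \<longleftrightarrow> s dvd m"
    using obtain_primitive_root[OF \<open>s > 0\<close>] by metis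
  define c where "c = (\<lambda>j. inverse (w ^ (i * j)))"
  define \<theta> where "\<theta> = (\<lambda>r::complex poly. - ([:0, 1:] * pderiv r))"
  let ?r = "monom 1 i * pcompose A (monom 1 s)"

  \<comment> \<open>The filtered P vanishes for t > 0, so by uniqueness its expansion, the filtered
    expansion of G, is zero.\<close>
  have coeffs: "(\<Sum>j<s. c j * G_deriv g (w ^ j * \<zeta>) l) = 0"
    if "odd k" "(\<zeta> ^ s) ^ k = 1" for k l \<zeta>
  proof -
    have k: "k > 0" using that by (auto intro!: Nat.gr0I)
    have z1: "norm \<zeta> = 1"
      using power_eq_1_iff[of \<zeta> "s * k"] that(2) k \<open>s > 0\<close> by (simp add: power_mult)
    have "has_asymp_expansion_at_0 (\<lambda>t. P_series \<nu> a b chi (w ^ j * \<zeta> * exp (- of_real t)))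
            (G_fps g (w ^ j * \<zeta>))" for j
    proof (rule assms(6))
      \<comment> \<open>Oddness of \<open>s\<close> keeps all the points w^j \<zeta> among the roots
        of unity of odd order.\<close>
      show "odd (s * k)" using that \<open>odd s\<close> by simp
      have "(w ^ j) ^ (s * k) = 1" using w by (simp flip: power_mult)
      thus "(w ^ j * \<zeta>) ^ (s * k) = 1" using that(2) by (simp add: power_mult_distrib power_mult)
    qed
    hence "has_asymp_expansion_at_0
        (\<lambda>t. \<Sum>j<s. c j * P_series \<nu> a b chi (w ^ j * \<zeta> * exp (- of_real t)))
        (\<Sum>j<s. fps_const (c j) * G_fps g (w ^ j * \<zeta>))"
      by (intro has_asymp_expansion_at_0_sum) auto
    hence "(\<Sum>j<s. fps_const (c j) * G_fps g (w ^ j * \<zeta>)) = 0"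
    proof (rule has_asymp_expansion_at_0_zero)
      fix t :: real assume "t > 0"
      have "(\<Sum>j<s. c j * P_series \<nu> a b chi (w ^ j * (\<zeta> * exp (- of_real t)))) = 0"
        unfolding c_def
        by (rule P_series_dissection_vanishes[where B = B])
           (use assms B w z1 \<open>t > 0\<close> in \<open>auto simp: norm_mult\<close>)
      thus "(\<Sum>j<s. c j * P_series \<nu> a b chi (w ^ j * \<zeta> * exp (- of_real t))) = 0"
        by (simp only: mult.assoc)
    qed
    hence "fps_nth (\<Sum>j<s. fps_const (c j) * G_fps g (w ^ j * \<zeta>)) l = 0" by simp
    hence "(\<Sum>j<s. c j * G_deriv g (w ^ j * \<zeta>) l) / fact l = 0"
      by (simp add: fps_sum_nth G_fps_def sum_divide_distrib)
    thus ?thesis by simp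
  qed

  \<comment> \<open>In this range of \<open>l\<close> the derivative of G at each w^j \<zeta> is
    already attained by \<open>G_partial g N\<close>, so the identity for expansions becomes one for
    polynomials.\<close>
  have euler: "poly ((\<theta> ^^ l) ?r) \<zeta> = 0"
    if "odd k" "(\<zeta> ^ s) ^ k = 1" "k * (2 * l + 1) \<le> 2 * \<mu> - 1" for k l \<zeta>
  proof -
    have le: "s * k * (2 * l + 1) \<le> 2 * N"
      using order_trans[OF mult_le_mono2[OF that(3), of s] \<mu>] by (simp only: mult.assoc)
    have "G_deriv g (w ^ j * \<zeta>) l = poly ((\<theta> ^^ l) (pcompose (G_partial g N) [:0, w ^ j:])) \<zeta>" for j
    proof -
      have "(w ^ j) ^ (s * k) = 1" using w by (simp flip: power_mult)
      hence "(w ^ j * \<zeta>) ^ (s * k) = 1" using that(2) by (simp add: power_mult_distrib power_mult)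
      hence "G_deriv g (w ^ j * \<zeta>) l = G_deriv_partial g (w ^ j * \<zeta>) l N"
        using that \<open>odd s\<close> le by (intro G_deriv_eq[of "s * k"]) auto
      also have "\<dots> = (deriv ^^ l)
          (\<lambda>t. poly (pcompose (G_partial g N) [:0, w ^ j:]) (\<zeta> * exp (- t))) 0"
        by (simp add: G_deriv_partial_def poly_pcompose mult_ac)
      also have "\<dots> = poly ((\<theta> ^^ l) (pcompose (G_partial g N) [:0, w ^ j:])) \<zeta>"
        unfolding higher_deriv_poly_exp \<theta>_def by simp
      finally show ?thesis .
    qed
    hence "(\<Sum>j<s. c j * G_deriv g (w ^ j * \<zeta>) l) =
        poly ((\<theta> ^^ l) (\<Sum>j<s. smult (c j) (pcompose (G_partial g N) [:0, w ^ j:]))) \<zeta>"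
      unfolding \<theta>_def by (simp only: euler_op_sum euler_op_smult poly_sum poly_smult)
    also have "\<dots> = of_nat s * poly ((\<theta> ^^ l) ?r) \<zeta>"
      unfolding c_def sum_dissect_root_of_unity[OF \<open>s > 0\<close> w \<open>i < s\<close>] A_def A_G_def \<theta>_def
        euler_op_smult by (rule poly_smult)
    finally show ?thesis using coeffs[OF that(1,2)] \<open>s > 0\<close> by simp
  qed

  have "odd_qpoch \<mu> dvd A"
  proof (rule poly_dvd_of_order_le)
    show "odd_qpoch \<mu> \<noteq> 0" by (rule odd_qpoch_nonzero)
    show "A \<noteq> 0" using False by (simp add: A_def)
    fix \<omega> :: complex
    show "order \<omega> (odd_qpoch \<mu>) \<le> order \<omega> A"
    proof (rule order_odd_qpoch_le)
      fix k l assume k: "odd k" "\<omega> ^ k = 1" "k * (2 * l + 1) \<le> 2 * \<mu> - 1"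
      \<comment> \<open>Any s-th root of \<omega> serves, since \<open>?r\<close> involves
        \<open>A\<close> only through q^s.\<close>
      obtain \<zeta> where z: "\<omega> = \<zeta> ^ s"
        using exists_complex_root[of s \<omega>] \<open>s > 0\<close> by auto
      have "\<omega> \<noteq> 0" using k by (auto simp: power_0_left split: if_splits)
      hence z0: "\<zeta> \<noteq> 0" using z \<open>s > 0\<close> by (auto simp: power_0_left)
      \<comment> \<open>The bound on \<open>l\<close> is inherited by all smaller orders, so the l +
        1 derivatives of orders 0 to l all vanish; this gives the strict inequality l <
        order.\<close>
      have "[:-\<zeta>, 1:] ^ Suc l dvd ?r"
      proof (rule euler_op_dvd_converse[OF z0])
        fix l' assume "l' < Suc l"
        hence "k * (2 * l' + 1) \<le> k * (2 * l + 1)" by (intro mult_le_mono2) auto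
        hence "k * (2 * l' + 1) \<le> 2 * \<mu> - 1" using k(3) by (rule order_trans)
        from euler[OF k(1) k(2)[unfolded z] this]
        show "poly (((\<lambda>r. - ([:0, 1:] * pderiv r)) ^^ l') ?r) \<zeta> = 0"
          unfolding \<theta>_def .
      qed
      moreover have "?r \<noteq> 0"
        using \<open>A \<noteq> 0\<close> \<open>s > 0\<close> by (simp add: pcompose_eq_0_iff degree_monom_eq)
      ultimately have "Suc l \<le> order \<zeta> ?r" by (simp only: order_divides) simp
      thus "l < order \<omega> A"
        using order_pcompose_monom[OF \<open>s > 0\<close> z0 \<open>A \<noteq> 0\<close>] z by simp
    qed
  qed
  thus ?thesis by (simp add: A_def \<mu>_def)
qed simp

end
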